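(* Let $1\le r<n$ and let $T=\begin{bmatrix} X & Y\\ 0 & Z\end{bmatrix}$ be an $n\times n$ complex matrix, where $X$ is $r\times r$, $Z$ is $(n-r)\times(n-r)$, $Y$ is $r\times(n-r)$, and $0$ is the $(n-r)\times r$ zero block. Then $$\det\left(I_n+T^*T\right)\ge \det\left(I_r+X^*X\right)\cdot\det\left(I_{n-r}+Z^*Z\right).$$ Moreover, equality holds if and only if $Y=0$.
   Context: All matrices have complex entries. $X^*$ denotes the conjugate transpose of $X$, and $I_n$ is the $n\times n$ identity matrix. *)

theory Defs
  imports
    "Jordan_Normal_Form.Determinant"
    "Jordan_Normal_Form.Schur_Decomposition"
begin

end

theory Submission
  imports Defs
begin

text \<open>Taking the Schur complement of \<open>A = I + X\<^sup>* X\<close> in \<open>I + T\<^sup>* T\<close> gives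
  \<open>det (I + T\<^sup>* T) = det A * det (P + Y\<^sup>* K Y)\<close> with \<open>P = I + Z\<^sup>* Z\<close> and, by the Woodbury
  identity, \<open>K = I - X A\<^sup>-\<^sup>1 X\<^sup>* = (I + X X\<^sup>*)\<^sup>-\<^sup>1\<close>. Since \<open>K = K (I + X X\<^sup>*) K\<close>, the
  perturbation is a sum of Gram matrices, \<open>Y\<^sup>* K Y = F\<^sup>* F + G\<^sup>* G\<close> with \<open>F = K Y\<close> and
  \<open>G = X\<^sup>* K Y\<close>, and \<open>F = 0\<close> forces \<open>Y = 0\<close>. It remains to see that adding a Gram matrix
  \<open>F\<^sup>* F\<close> to a positive definite \<open>P\<close> increases the determinant, strictly unless \<open>F = 0\<close>: the
  eigenvalues of \<open>P\<^sup>-\<^sup>1 F\<^sup>* F\<close> are nonnegative, so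
  \<open>det (I + P\<^sup>-\<^sup>1 F\<^sup>* F) \<ge> 1 + tr (P\<^sup>-\<^sup>1 F\<^sup>* F) = 1 + tr (F P\<^sup>-\<^sup>1 F\<^sup>*)\<close>, and the diagonal
  entries of \<open>F P\<^sup>-\<^sup>1 F\<^sup>*\<close> are positive at the nonzero rows of \<open>F\<close>.\<close>

section \<open>Algebra of the conjugate transpose\<close>

lemma mat_adjoint_dim [simp]:
  "dim_row (mat_adjoint A) = dim_col A" "dim_col (mat_adjoint A) = dim_row A"
  by (auto simp: mat_adjoint_def)

lemma mat_adjoint_carrier [simp, intro]:
  "A \<in> carrier_mat m n \<Longrightarrow> mat_adjoint A \<in> carrier_mat n m"
  by (metis carrier_matD carrier_matI mat_adjoint_dim)

lemma mat_adjoint_index [simp]: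
  "i < dim_col A \<Longrightarrow> j < dim_row A \<Longrightarrow> mat_adjoint A $$ (i, j) = conjugate (A $$ (j, i))"
  by (auto simp: mat_adjoint_def mat_of_rows_def)

lemma mat_adjoint_involutive [simp]: "mat_adjoint (mat_adjoint A) = A"
  by (intro eq_matI) auto

lemma mat_adjoint_one [simp]: "mat_adjoint (1\<^sub>m n) = (1\<^sub>m n :: complex mat)"
  by (intro eq_matI) auto

lemma mat_adjoint_plus:
  fixes A B :: "complex mat"
  assumes "A \<in> carrier_mat m n" "B \<in> carrier_mat m n"
  shows "mat_adjoint (A + B) = mat_adjoint A + mat_adjoint B"
  using assms by (intro eq_matI) auto

lemma mat_adjoint_mult:
  fixes A B :: "complex mat"
  assumes "A \<in> carrier_mat m n" "B \<in> carrier_mat n k"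
  shows "mat_adjoint (A * B) = mat_adjoint B * mat_adjoint A"
  using assms by (intro eq_matI) (auto simp: scalar_prod_def mult.commute)

lemma mat_adjoint_four_block:
  fixes A B C D :: "complex mat"
  assumes "A \<in> carrier_mat r p" "B \<in> carrier_mat r q" "C \<in> carrier_mat m p" "D \<in> carrier_mat m q"
  shows "mat_adjoint (four_block_mat A B C D) =
    four_block_mat (mat_adjoint A) (mat_adjoint C) (mat_adjoint B) (mat_adjoint D)"
  using assms by (intro eq_matI) auto

text \<open>The entrywise conjugate of \<open>mat_adjoint A\<close> is the transpose of
  \<open>A\<close>, so the bilinear transpose rule applies. This later turns quadratic forms of Gram
  matrices into squared norms.\<close>

lemma mult_mat_vec_cscalar_prod_adjoint:
  fixes A :: "complex mat"
  assumes A: "A \<in> carrier_mat m n" and v: "v \<in> carrier_vec n" and w: "w \<in> carrier_vec m"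
  shows "(A *\<^sub>v v) \<bullet>c w = v \<bullet>c (mat_adjoint A *\<^sub>v w)"
proof -
  have "conjugate (mat_adjoint A *\<^sub>v w) = transpose_mat A *\<^sub>v conjugate w"
    using assms by (intro eq_vecI) (auto simp: scalar_prod_def)
  then have "v \<bullet>c (mat_adjoint A *\<^sub>v w) = (transpose_mat A *\<^sub>v conjugate w) \<bullet> v"
    using assms by (metis comm_scalar_prod mult_mat_vec_carrier transpose_carrier_mat carrier_vec_conjugate)
  also have "\<dots> = conjugate w \<bullet> (A *\<^sub>v v)"
    using assms by (simp add: transpose_vec_mult_scalar)
  also have "\<dots> = (A *\<^sub>v v) \<bullet>c w"
    using assms by (metis comm_scalar_prod mult_mat_vec_carrier carrier_vec_conjugate)
  finally show ?thesis ..
qed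

section \<open>Trace, determinant and eigenvalues\<close>

definition mat_trace :: "'a :: comm_monoid_add mat \<Rightarrow> 'a" where
  "mat_trace A = (\<Sum>i<dim_row A. A $$ (i, i))"

lemma mat_trace_eq_sum_list_diag: "mat_trace A = sum_list (diag_mat A)"
  by (simp add: mat_trace_def diag_mat_def interv_sum_list_conv_sum_set_nat atLeast0LessThan)

lemma mat_trace_mult_commute:
  fixes A B :: "'a :: comm_semiring_0 mat"
  assumes "A \<in> carrier_mat m n" "B \<in> carrier_mat n m"
  shows "mat_trace (A * B) = mat_trace (B * A)"
proof -
  have "mat_trace (A * B) = (\<Sum>i<m. \<Sum>j<n. A $$ (i, j) * B $$ (j, i))"
    using assms by (auto simp: mat_trace_def scalar_prod_def atLeast0LessThan)
  also have "\<dots> = (\<Sum>j<n. \<Sum>i<m. B $$ (j, i) * A $$ (i, j))"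
    by (subst sum.swap) (simp add: mult.commute)
  also have "\<dots> = mat_trace (B * A)"
    using assms by (auto simp: mat_trace_def scalar_prod_def atLeast0LessThan)
  finally show ?thesis .
qed

text \<open>Schur triangularization makes \<open>M\<close> similar to an upper triangular matrix
  with diagonal \<open>es\<close>; determinant and trace are similarity invariants and can be read
  off there.\<close>

lemma eigenvalue_list:
  fixes M :: "complex mat"
  assumes M: "M \<in> carrier_mat n n"
  obtains es where "det M = prod_list es" "det (1\<^sub>m n + M) = prod_list (map (\<lambda>e. 1 + e) es)"
    "mat_trace M = sum_list es" "\<And>e. e \<in> set es \<Longrightarrow> eigenvalue M e"
proof -
  obtain es where cp: "char_poly M = (\<Prod>e\<leftarrow>es. [:- e, 1:])"
    using char_poly_factorized[OF M] by blast
  obtain B P Q where "schur_decomposition M es = (B, P, Q)"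
    by (cases "schur_decomposition M es") auto
  from schur_decomposition[OF M cp this]
  have sim: "similar_mat_wit M B P Q" and ut: "upper_triangular B" and diag: "diag_mat B = es"
    by auto
  note w = similar_mat_witD2[OF M sim]
  have B: "B \<in> carrier_mat n n" and P: "P \<in> carrier_mat n n" and Q: "Q \<in> carrier_mat n n"
    using w by auto
  have 1: "det M = prod_list es"
    using det_similar[of M B] sim det_upper_triangular[OF ut B] diag
    by (auto simp: similar_mat_def)
  \<comment> \<open>Since \<open>P * Q\<close> is the identity, the similarity between
    \<open>M\<close> and \<open>B\<close> survives the shift by the identity.\<close>
  have "P * (1\<^sub>m n + B) * Q = 1\<^sub>m n + M"
    using w by (simp add: mult_add_distrib_mat[of _ n n _ n] add_mult_distrib_mat[of _ n n _ _ n])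
  then have "similar_mat (1\<^sub>m n + M) (1\<^sub>m n + B)"
    using w by (intro similar_matI[of _ _ P Q n]) auto
  then have "det (1\<^sub>m n + M) = det (1\<^sub>m n + B)"
    by (rule det_similar)
  also have "\<dots> = prod_list (diag_mat (1\<^sub>m n + B))"
    using ut B by (intro det_upper_triangular[of _ n] upper_triangularI) auto
  also have "diag_mat (1\<^sub>m n + B) = map (\<lambda>e. 1 + e) es"
    using B unfolding diag[symmetric] by (auto simp: diag_mat_def)
  finally have 2: "det (1\<^sub>m n + M) = prod_list (map (\<lambda>e. 1 + e) es)" .
  have "mat_trace M = mat_trace (P * (B * Q))"
    using w by simp
  also have "\<dots> = mat_trace (B * Q * P)"
    using B P Q by (intro mat_trace_mult_commute[of _ n n]) auto
  also have "B * Q * P = B"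
    using w by simp
  finally have 3: "mat_trace M = sum_list es"
    by (simp add: mat_trace_eq_sum_list_diag diag)
  have "eigenvalue M e" if "e \<in> set es" for e
    unfolding eigenvalue_root_char_poly[OF M] cp using that
    by (auto simp: poly_prod_list prod_list_zero_iff)
  with 1 2 3 that show thesis by blast
qed

text \<open>Weierstrass product inequality: expanding \<open>(1 + e) * (1 + s)\<close> yields the
  extra term \<open>e * s\<close>, which is nonnegative.\<close>

lemma prod_list_one_plus_ge:
  fixes es :: "complex list"
  assumes "\<And>e. e \<in> set es \<Longrightarrow> 0 \<le> e"
  shows "1 + sum_list es \<le> prod_list (map (\<lambda>e. 1 + e) es)"
  using assms
proof (induction es)
  case (Cons e es)
  have e: "0 \<le> e" and s: "0 \<le> sum_list es"
    using Cons.prems by (auto intro: sum_list_nonneg)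
  have "1 + sum_list (e # es) \<le> (1 + e) * (1 + sum_list es)"
    using mult_nonneg_nonneg[OF e s] by (simp add: algebra_simps)
  also have "\<dots> \<le> (1 + e) * prod_list (map (\<lambda>e. 1 + e) es)"
    using Cons e by (intro mult_left_mono) (auto simp: less_eq_complex_def)
  finally show ?case by simp
qed simp

lemma prod_list_pos_complex:
  fixes es :: "complex list"
  assumes "\<And>e. e \<in> set es \<Longrightarrow> 0 < e"
  shows "0 < prod_list es"
  using assms by (induction es) (auto simp: less_complex_def)

text \<open>The assumption concerns the spectrum, not a quadratic form, because the intended matrix
  \<open>N * (mat_adjoint F * F)\<close> is in general not Hermitian.\<close>

lemma det_one_plus_ge:
  fixes M :: "complex mat"
  assumes M: "M \<in> carrier_mat n n" and ev: "\<And>e. eigenvalue M e \<Longrightarrow> 0 \<le> e"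
  shows "1 + mat_trace M \<le> det (1\<^sub>m n + M)"
  using eigenvalue_list[OF M] prod_list_one_plus_ge ev by metis

section \<open>Positive definite matrices\<close>

text \<open>Over the complex numbers this already forces \<open>P\<close> to be Hermitian, because \<open>0 < z\<close> includes
  that \<open>z\<close> is real.\<close>

definition pos_def_mat :: "nat \<Rightarrow> complex mat \<Rightarrow> bool" where
  "pos_def_mat n P \<longleftrightarrow> P \<in> carrier_mat n n \<and>
     (\<forall>v \<in> carrier_vec n. v \<noteq> 0\<^sub>v n \<longrightarrow> 0 < (P *\<^sub>v v) \<bullet>c v)"

lemma cscalar_prod_gram:
  fixes F :: "complex mat"
  assumes F: "F \<in> carrier_mat m n" and v: "v \<in> carrier_vec n"
  shows "((mat_adjoint F * F) *\<^sub>v v) \<bullet>c v = (F *\<^sub>v v) \<bullet>c (F *\<^sub>v v)"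
  using mult_mat_vec_cscalar_prod_adjoint[of "mat_adjoint F" n m "F *\<^sub>v v" v] assms
  by (simp add: assoc_mult_mat_vec[of _ n m _ n])

lemma pos_def_mat_one: "pos_def_mat n (1\<^sub>m n)"
  by (auto simp: pos_def_mat_def)

text \<open>The Gram matrix contributes the squared norm of \<open>F v\<close> to the quadratic form
  at \<open>v\<close>.\<close>

lemma pos_def_mat_plus_gram:
  assumes P: "pos_def_mat n P" and F: "F \<in> carrier_mat m n"
  shows "pos_def_mat n (P + mat_adjoint F * F)"
  unfolding pos_def_mat_def
proof (intro conjI ballI impI)
  fix v :: "complex vec"
  assume v: "v \<in> carrier_vec n" "v \<noteq> 0\<^sub>v n"
  have Pc: "P \<in> carrier_mat n n" and "0 < (P *\<^sub>v v) \<bullet>c v"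
    using P v by (auto simp: pos_def_mat_def)
  have Q: "mat_adjoint F * F \<in> carrier_mat n n"
    using F by auto
  have "0 < (P *\<^sub>v v) \<bullet>c v + (F *\<^sub>v v) \<bullet>c (F *\<^sub>v v)"
    using \<open>0 < (P *\<^sub>v v) \<bullet>c v\<close> by (intro add_pos_nonneg) auto
  also have "\<dots> = ((P + mat_adjoint F * F) *\<^sub>v v) \<bullet>c v"
    unfolding cscalar_prod_gram[OF F v(1), symmetric] add_mult_distrib_mat_vec[OF Pc Q v(1)]
    using Pc Q v by (intro add_scalar_prod_distrib[symmetric, of _ n]) auto
  finally show "0 < ((P + mat_adjoint F * F) *\<^sub>v v) \<bullet>c v" .
qed (use P F in \<open>auto simp: pos_def_mat_def\<close>)

lemma cscalar_prod_commute_cnj: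
  fixes v w :: "complex vec"
  assumes "v \<in> carrier_vec n" "w \<in> carrier_vec n"
  shows "v \<bullet>c w = cnj (w \<bullet>c v)"
  using assms by (auto simp: scalar_prod_def mult.commute)

lemma pos_def_mat_det_pos:
  assumes P: "pos_def_mat n P"
  shows "0 < det P"
proof -
  have Pc: "P \<in> carrier_mat n n"
    using P by (simp add: pos_def_mat_def)
  have "0 < e" if ev: "eigenvalue P e" for e
  proof -
    obtain v where v: "v \<in> carrier_vec n" "v \<noteq> 0\<^sub>v n" "P *\<^sub>v v = e \<cdot>\<^sub>v v"
      using ev Pc unfolding eigenvalue_def eigenvector_def by auto
    then have "0 < e * (v \<bullet>c v)" and "0 < v \<bullet>c v"
      using P by (auto simp: pos_def_mat_def dest!: bspec[of _ _ v])
    then show ?thesis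
      by (auto simp: less_complex_def zero_less_mult_iff)
  qed
  then show ?thesis
    using eigenvalue_list[OF Pc] prod_list_pos_complex by metis
qed

lemma obtain_mat_inverse:
  fixes A :: "'a :: field mat"
  assumes "A \<in> carrier_mat n n" "det A \<noteq> 0"
  obtains N where "N \<in> carrier_mat n n" "A * N = 1\<^sub>m n" "N * A = 1\<^sub>m n"
  using det_non_zero_imp_unit[OF assms, of "()"] by (auto simp: Units_def ring_mat_def)

text \<open>Writing \<open>v = P u\<close> with \<open>u = N v\<close> turns the form of
  \<open>N\<close> at \<open>v\<close> into the conjugate of the form of \<open>P\<close> at
  \<open>u\<close>.\<close>

lemma pos_def_mat_inverse:
  assumes P: "pos_def_mat n P" and N: "N \<in> carrier_mat n n" "P * N = 1\<^sub>m n"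
  shows "pos_def_mat n N"
  unfolding pos_def_mat_def
proof (intro conjI ballI impI)
  fix v :: "complex vec"
  assume v: "v \<in> carrier_vec n" "v \<noteq> 0\<^sub>v n"
  have Pc: "P \<in> carrier_mat n n"
    using P by (simp add: pos_def_mat_def)
  let ?u = "N *\<^sub>v v"
  have u: "?u \<in> carrier_vec n" using N v by auto
  have Pu: "P *\<^sub>v ?u = v"
    using assoc_mult_mat_vec[OF Pc N(1) v(1)] N v by simp
  moreover have "P *\<^sub>v 0\<^sub>v n = 0\<^sub>v n"
    using Pc by (intro eq_vecI) auto
  ultimately have "?u \<noteq> 0\<^sub>v n"
    using v(2) by metis
  with u P have "0 < v \<bullet>c ?u"
    unfolding pos_def_mat_def by (metis Pu)
  \<comment> \<open>A positive complex number is real, so conjugation preserves positivity.\<close>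
  then show "0 < ?u \<bullet>c v"
    unfolding cscalar_prod_commute_cnj[OF u v(1)] by (simp add: less_complex_def)
qed (use N in auto)

section \<open>Determinant growth under adding a Gram matrix\<close>

text \<open>The \<open>i\<close>-th diagonal entry is the form of \<open>N\<close> at column
  \<open>i\<close> of \<open>mat_adjoint F\<close>, so a vanishing trace kills every such
  column.\<close>

lemma mat_trace_congruence:
  fixes N F :: "complex mat"
  assumes N: "pos_def_mat n N" and F: "F \<in> carrier_mat m n"
  shows "0 \<le> mat_trace (F * N * mat_adjoint F)"
    and "mat_trace (F * N * mat_adjoint F) = 0 \<Longrightarrow> F = 0\<^sub>m m n"
proof -
  let ?f = "\<lambda>i. col (mat_adjoint F) i"
  have Nc: "N \<in> carrier_mat n n"
    using N by (simp add: pos_def_mat_def)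
  have f: "?f i \<in> carrier_vec n" if "i < m" for i
    using F that by auto
  have diag: "(F * N * mat_adjoint F) $$ (i, i) = (N *\<^sub>v ?f i) \<bullet>c ?f i" if "i < m" for i
  proof -
    have "row F i = conjugate (?f i)"
      using F that by (intro eq_vecI) auto
    moreover have "F * N * mat_adjoint F = F * (N * mat_adjoint F)"
      using F Nc assoc_mult_mat[OF F Nc, of "mat_adjoint F" m] by auto
    moreover have "(F * (N * mat_adjoint F)) $$ (i, i) = row F i \<bullet> (N *\<^sub>v ?f i)"
      using F Nc that by (simp add: col_mult2[of N n n _ m])
    ultimately show ?thesis
      using f[OF that] Nc comm_scalar_prod[of "conjugate (?f i)" n "N *\<^sub>v ?f i"] by auto
  qed
  have nonneg: "0 \<le> (N *\<^sub>v ?f i) \<bullet>c ?f i" if "i < m" for i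
    using N f[OF that] Nc by (cases "?f i = 0\<^sub>v n") (auto simp: pos_def_mat_def)
  have tr: "mat_trace (F * N * mat_adjoint F) = (\<Sum>i<m. (N *\<^sub>v ?f i) \<bullet>c ?f i)"
    using F diag by (auto simp: mat_trace_def)
  show "0 \<le> mat_trace (F * N * mat_adjoint F)"
    unfolding tr using nonneg by (intro sum_nonneg) auto
  assume "mat_trace (F * N * mat_adjoint F) = 0"
  then have "(N *\<^sub>v ?f i) \<bullet>c ?f i = 0" if "i < m" for i
    using that nonneg unfolding tr by (subst (asm) sum_nonneg_eq_0_iff) auto
  then have f0: "?f i = 0\<^sub>v n" if "i < m" for i
    using N f[OF that] that unfolding pos_def_mat_def by (metis less_irrefl)
  show "F = 0\<^sub>m m n"
  proof (intro eq_matI)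
    fix i j assume ij: "i < dim_row (0\<^sub>m m n :: complex mat)" "j < dim_col (0\<^sub>m m n :: complex mat)"
    then have "?f i $ j = 0"
      using f0 by simp
    then show "F $$ (i, j) = 0\<^sub>m m n $$ (i, j)"
      using ij F by simp
  qed (use F in auto)
qed

text \<open>Factoring out \<open>P\<close> leaves a determinant that is at least 1 plus a
  nonnegative trace, and this trace vanishes only for \<open>F = 0\<close>.\<close>

lemma det_pos_def_plus_gram:
  fixes P F :: "complex mat"
  assumes P: "pos_def_mat n P" and F: "F \<in> carrier_mat m n"
  shows "det P \<le> det (P + mat_adjoint F * F)"
    and "det (P + mat_adjoint F * F) = det P \<Longrightarrow> F = 0\<^sub>m m n"
proof -
  have Pc: "P \<in> carrier_mat n n"
    using P by (simp add: pos_def_mat_def)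
  have dP: "0 < det P" by (rule pos_def_mat_det_pos[OF P])
  obtain N where N: "N \<in> carrier_mat n n" "P * N = 1\<^sub>m n" "N * P = 1\<^sub>m n"
    using obtain_mat_inverse[OF Pc] dP by (metis less_irrefl)
  have Npd: "pos_def_mat n N" by (rule pos_def_mat_inverse[OF P N(1,2)])
  let ?Q = "mat_adjoint F * F"
  have Q: "?Q \<in> carrier_mat n n" using F by auto
  have "P * (1\<^sub>m n + N * ?Q) = P + ?Q"
    using Pc N Q assoc_mult_mat[OF Pc N(1) Q] left_mult_one_mat[OF Q] by (simp add: mult_add_distrib_mat[of _ n n _ n])
  then have fact: "det (P + ?Q) = det P * det (1\<^sub>m n + N * ?Q)"
    using Pc N Q det_mult[of P n "1\<^sub>m n + N * ?Q"] by simp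
  \<comment> \<open>An eigenvector \<open>v\<close> of \<open>N * ?Q\<close> satisfies
    \<open>?Q v = e P v\<close>, so \<open>e\<close> is the quotient of a nonnegative form by a
    positive one.\<close>
  have nonneg: "0 \<le> e" if ev: "eigenvalue (N * ?Q) e" for e
  proof -
    obtain v where v: "v \<in> carrier_vec n" "v \<noteq> 0\<^sub>v n" "(N * ?Q) *\<^sub>v v = e \<cdot>\<^sub>v v"
      using ev N Q unfolding eigenvalue_def eigenvector_def by auto
    have "?Q *\<^sub>v v = (P * N) *\<^sub>v (?Q *\<^sub>v v)"
      using N Q F v by simp
    also have "\<dots> = P *\<^sub>v ((N * ?Q) *\<^sub>v v)"
      using Pc N(1) Q v by (simp only: assoc_mult_mat_vec mult_mat_vec_carrier)
    also have "\<dots> = e \<cdot>\<^sub>v (P *\<^sub>v v)"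
      using v Pc by (simp add: mult_mat_vec)
    finally have "(?Q *\<^sub>v v) \<bullet>c v = e * ((P *\<^sub>v v) \<bullet>c v)"
      using v Pc by (simp add: smult_scalar_prod_distrib[of _ n])
    moreover have "0 \<le> (?Q *\<^sub>v v) \<bullet>c v"
      using cscalar_prod_gram[OF F v(1)] by auto
    moreover have "0 < (P *\<^sub>v v) \<bullet>c v"
      using P v by (auto simp: pos_def_mat_def)
    ultimately show ?thesis
      by (auto simp: less_complex_def less_eq_complex_def zero_le_mult_iff)
  qed
  \<comment> \<open>Cyclicity of the trace moves \<open>F\<close> to the front, giving a congruence
    of \<open>N\<close>.\<close>
  have "mat_trace (N * ?Q) = mat_trace ((N * mat_adjoint F) * F)"
    using N F by (simp add: assoc_mult_mat[of N n n "mat_adjoint F" m F n])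
  also have "\<dots> = mat_trace (F * N * mat_adjoint F)"
    using N F by (subst mat_trace_mult_commute[of _ n m]) (auto simp: assoc_mult_mat[of F m n N n _ m])
  finally have tr: "mat_trace (N * ?Q) = mat_trace (F * N * mat_adjoint F)" .
  have ge: "1 + mat_trace (N * ?Q) \<le> det (1\<^sub>m n + N * ?Q)"
    using N Q nonneg by (intro det_one_plus_ge) auto
  have tr0: "0 \<le> mat_trace (N * ?Q)"
    unfolding tr by (rule mat_trace_congruence[OF Npd F])
  have "1 \<le> 1 + mat_trace (N * ?Q)" using tr0 by simp
  also note ge
  finally have "det P * 1 \<le> det P * det (1\<^sub>m n + N * ?Q)"
    using dP by (intro mult_left_mono) auto
  then show "det P \<le> det (P + ?Q)"
    by (simp add: fact)
  assume "det (P + ?Q) = det P"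
  then have "det (1\<^sub>m n + N * ?Q) = 1"
    using fact dP by auto
  then have "mat_trace (N * ?Q) = 0"
    using ge tr0 by (simp add: order_antisym)
  then show "F = 0\<^sub>m m n"
    unfolding tr by (rule mat_trace_congruence[OF Npd F])
qed

section \<open>Schur complement and Woodbury identity\<close>

text \<open>Block LU factorization: the two triangular factors have determinants
  \<open>det A\<close> and that of the Schur complement.\<close>

lemma det_four_block_schur_complement:
  fixes A B C D N :: "'a :: idom mat"
  assumes A: "A \<in> carrier_mat r r" and B: "B \<in> carrier_mat r m"
    and C: "C \<in> carrier_mat m r" and D: "D \<in> carrier_mat m m"
    and N: "N \<in> carrier_mat r r" "A * N = 1\<^sub>m r"
  shows "det (four_block_mat A B C D) = det A * det (D - C * (N * B))"
proof -
  let ?S = "D - C * (N * B)"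
  have S: "?S \<in> carrier_mat m m" using B C D N by auto
  have "four_block_mat A (0\<^sub>m r m) C (1\<^sub>m m) * four_block_mat (1\<^sub>m r) (N * B) (0\<^sub>m m r) ?S
      = four_block_mat A (A * (N * B)) C (C * (N * B) + ?S)"
    using A B C D N S by (subst mult_four_block_mat[of _ r r _ m _ m _ _ r _ m]) auto
  also have "A * (N * B) = B"
    using assoc_mult_mat[OF A N(1) B] N B by simp
  also have "C * (N * B) + ?S = D"
    using B C D N by (intro eq_matI) auto
  finally have "det (four_block_mat A B C D) =
      det (four_block_mat A (0\<^sub>m r m) C (1\<^sub>m m)) * det (four_block_mat (1\<^sub>m r) (N * B) (0\<^sub>m m r) ?S)"
    using A B C N S det_mult[of "four_block_mat A (0\<^sub>m r m) C (1\<^sub>m m)" "r + m"]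
    by (metis four_block_carrier_mat one_carrier_mat)
  moreover have "det (four_block_mat A (0\<^sub>m r m) C (1\<^sub>m m)) = det A"
    using det_four_block_mat_upper_right_zero[OF A refl C one_carrier_mat] by simp
  moreover have "det (four_block_mat (1\<^sub>m r) (N * B) (0\<^sub>m m r) ?S) = det ?S"
    using det_four_block_mat_lower_left_zero[OF one_carrier_mat _ refl S, of "N * B" r] N B by simp
  ultimately show ?thesis by simp
qed

text \<open>The Woodbury identity
  \<open>I - X (I + X\<^sup>* X)\<^sup>-\<^sup>1 X\<^sup>* = (I + X X\<^sup>*)\<^sup>-\<^sup>1\<close>, with \<open>N\<close> for \<open>(I + X\<^sup>* X)\<^sup>-\<^sup>1\<close>.\<close>

lemma woodbury_one_plus_gram:
  fixes X N :: "complex mat"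
  assumes X: "X \<in> carrier_mat m r" and N: "N \<in> carrier_mat r r"
    and AN: "(1\<^sub>m r + mat_adjoint X * X) * N = 1\<^sub>m r"
  defines "K \<equiv> 1\<^sub>m m - X * (N * mat_adjoint X)"
  shows "K \<in> carrier_mat m m" and "(1\<^sub>m m + X * mat_adjoint X) * K = 1\<^sub>m m"
    and "mat_adjoint K = K"
proof -
  let ?X = "mat_adjoint X"
  have Xa: "?X \<in> carrier_mat r m" using X by auto
  show K: "K \<in> carrier_mat m m" unfolding K_def using X N by auto
  have NX: "N * ?X \<in> carrier_mat r m" using N Xa by auto
  have A: "1\<^sub>m r + ?X * X \<in> carrier_mat r r" using X by auto
  let ?B = "1\<^sub>m m + X * ?X"
  have B: "?B \<in> carrier_mat m m" using X by auto
  \<comment> \<open>Push-through identity: it brings \<open>1 + ?X * X\<close> next to its inverse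
    \<open>N\<close>.\<close>
  have "?B * X = X * (1\<^sub>m r + ?X * X)"
    using X Xa by (simp add: add_mult_distrib_mat[of _ m m _ _ r]
        mult_add_distrib_mat[OF X one_carrier_mat mult_carrier_mat[OF Xa X]]
        assoc_mult_mat[of X m r ?X m X r])
  then have "?B * (X * (N * ?X)) = X * (1\<^sub>m r + ?X * X) * (N * ?X)"
    using assoc_mult_mat[OF B X NX] by simp
  also have "\<dots> = X * ((1\<^sub>m r + ?X * X) * N * ?X)"
    unfolding assoc_mult_mat[OF X A NX] assoc_mult_mat[OF A N Xa] ..
  also have "\<dots> = X * ?X"
    unfolding AN left_mult_one_mat[OF Xa] ..
  finally have "?B * (X * (N * ?X)) = X * ?X" .
  then have "?B * K = ?B - X * ?X"
    unfolding K_def using B X NX by (simp add: mult_minus_distrib_mat[of _ m m _ m])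
  also have "\<dots> = 1\<^sub>m m"
    using X by (intro eq_matI) auto
  finally show BK: "?B * K = 1\<^sub>m m" .
  \<comment> \<open>As \<open>?B\<close> is Hermitian, \<open>mat_adjoint K\<close> is a left
    inverse of it; it must agree with the right inverse \<open>K\<close>.\<close>
  have "mat_adjoint ?B = ?B"
    using X by (simp add: mat_adjoint_plus[of _ m m] mat_adjoint_mult[of _ m r _ m])
  then have "mat_adjoint K * ?B = 1\<^sub>m m"
    using arg_cong[OF BK, of mat_adjoint] mat_adjoint_mult[OF B K] by simp
  then have "mat_adjoint K * (?B * K) = K"
    using assoc_mult_mat[OF _ B K, of "mat_adjoint K" m] K by simp
  then show "mat_adjoint K = K"
    using K BK by simp
qed

section \<open>The determinant inequality for block triangular matrices\<close>

theorem corollary2p3: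
  fixes n r :: nat and T X Y Z :: "complex mat"
  assumes "1 \<le> r" and "r < n"
    and "X \<in> carrier_mat r r"
    and "Y \<in> carrier_mat r (n - r)"
    and "Z \<in> carrier_mat (n - r) (n - r)"
    and "T = four_block_mat X Y (0\<^sub>m (n - r) r) Z"
  shows "det (1\<^sub>m n + mat_adjoint T * T)
           \<ge> det (1\<^sub>m r + mat_adjoint X * X) * det (1\<^sub>m (n - r) + mat_adjoint Z * Z)
    \<and> (det (1\<^sub>m n + mat_adjoint T * T)
           = det (1\<^sub>m r + mat_adjoint X * X) * det (1\<^sub>m (n - r) + mat_adjoint Z * Z)
         \<longleftrightarrow> Y = 0\<^sub>m r (n - r))"
proof -
  define m where "m = n - r"
  have n: "n = r + m" using assms(2) by (simp add: m_def)
  note X = assms(3) and Y = assms(4)[folded m_def] and Z = assms(5)[folded m_def]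
  let ?X = "mat_adjoint X" and ?Y = "mat_adjoint Y" and ?Z = "mat_adjoint Z"
  have Xa: "?X \<in> carrier_mat r r" and Ya: "?Y \<in> carrier_mat m r" and Za: "?Z \<in> carrier_mat m m"
    using X Y Z by auto
  let ?A = "1\<^sub>m r + ?X * X" and ?P = "1\<^sub>m m + ?Z * Z"
  have A: "pos_def_mat r ?A" and P: "pos_def_mat m ?P"
    using pos_def_mat_plus_gram[OF pos_def_mat_one] X Z by auto
  have Ac: "?A \<in> carrier_mat r r" and Pc: "?P \<in> carrier_mat m m"
    using X Z by auto
  have dA: "0 < det ?A" by (rule pos_def_mat_det_pos[OF A])
  obtain N where N: "N \<in> carrier_mat r r" "?A * N = 1\<^sub>m r"
    using obtain_mat_inverse[OF Ac] dA by (metis less_irrefl)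
  define K where "K = 1\<^sub>m r - X * (N * ?X)"
  note K = woodbury_one_plus_gram[OF X N, folded K_def]
  define F where "F = K * Y"
  define G where "G = ?X * F"
  have F: "F \<in> carrier_mat r m" and G: "G \<in> carrier_mat r m"
    using K Y X by (auto simp: F_def G_def)
  have Fa: "mat_adjoint F \<in> carrier_mat m r" using F by auto
  have D: "1\<^sub>m m + (?Y * Y + ?Z * Z) \<in> carrier_mat m m" using Y Z by auto
  have NXY: "N * (?X * Y) \<in> carrier_mat r m" using N Xa Y by auto
  \<comment> \<open>This recovers \<open>Y\<close> from \<open>F\<close>, so \<open>F = 0\<close>
    will force \<open>Y = 0\<close> in the equality case.\<close>
  have BF: "(1\<^sub>m r + X * ?X) * F = Y"
    unfolding F_def using assoc_mult_mat[OF _ K(1) Y, of "1\<^sub>m r + X * ?X" r] K X Y by simp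

  have "mat_adjoint F * F + mat_adjoint G * G = mat_adjoint F * F + mat_adjoint F * (X * ?X * F)"
    using X F assoc_mult_mat[OF Fa X mult_carrier_mat[OF Xa F]]
    by (simp add: G_def mat_adjoint_mult[OF Xa F] assoc_mult_mat[of X r r ?X r F m])
  also have "\<dots> = mat_adjoint F * ((1\<^sub>m r + X * ?X) * F)"
    using F mult_add_distrib_mat[OF Fa F mult_carrier_mat[OF mult_carrier_mat[OF X Xa] F]]
    by (simp add: add_mult_distrib_mat[OF one_carrier_mat mult_carrier_mat[OF X Xa] F])
  \<comment> \<open>Here \<open>K\<close> being Hermitian gives
    \<open>mat_adjoint F = ?Y * K\<close>.\<close>
  also have "\<dots> = ?Y * (K * Y)"
    unfolding BF unfolding F_def mat_adjoint_mult[OF K(1) Y] K(3) by (rule assoc_mult_mat[OF Ya K(1) Y])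
  also have "K * Y = Y - X * (N * (?X * Y))"
    unfolding K_def using X Xa N Y
    by (simp add: minus_mult_distrib_mat[of _ r r] assoc_mult_mat[of _ r r _ r Y m])
  also have "?Y * \<dots> = ?Y * Y - ?Y * X * (N * (?X * Y))"
    using mult_minus_distrib_mat[OF Ya Y mult_carrier_mat[OF X NXY]] assoc_mult_mat[OF Ya X NXY]
    by simp
  finally have gram: "mat_adjoint F * F + mat_adjoint G * G = ?Y * Y - ?Y * X * (N * (?X * Y))" .

  have "1\<^sub>m n + mat_adjoint T * T = four_block_mat ?A (?X * Y) (?Y * X) (1\<^sub>m m + (?Y * Y + ?Z * Z))"
  proof -
    have "mat_adjoint T = four_block_mat ?X (mat_adjoint (0\<^sub>m m r)) ?Y ?Z"
      unfolding assms(6) m_def[symmetric] using X Y Z by (intro mat_adjoint_four_block) auto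
    also have "mat_adjoint (0\<^sub>m m r) = (0\<^sub>m r m :: complex mat)"
      by (intro eq_matI) auto
    finally have TT: "mat_adjoint T * T = four_block_mat (?X * X) (?X * Y) (?Y * X) (?Y * Y + ?Z * Z)"
      unfolding assms(6) m_def[symmetric] using X Y Z Xa Ya Za
      by (simp add: mult_four_block_mat[of _ r r _ m _ m _ _ r _ m]
          right_add_zero_mat[OF mult_carrier_mat[OF Xa X]]
          right_add_zero_mat[OF mult_carrier_mat[OF Xa Y]]
          right_add_zero_mat[OF mult_carrier_mat[OF Ya X]])
    show ?thesis
      unfolding n TT using X Y Z by (intro eq_matI) auto
  qed
  then have "det (1\<^sub>m n + mat_adjoint T * T) =
      det ?A * det (1\<^sub>m m + (?Y * Y + ?Z * Z) - ?Y * X * (N * (?X * Y)))"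
    using det_four_block_schur_complement[OF Ac mult_carrier_mat[OF Xa Y] mult_carrier_mat[OF Ya X] D N]
    by simp
  also have "1\<^sub>m m + (?Y * Y + ?Z * Z) - ?Y * X * (N * (?X * Y)) =
      ?P + (?Y * Y - ?Y * X * (N * (?X * Y)))"
    using X Y Z Xa Ya Za N by (intro eq_matI) auto
  also have "\<dots> = ?P + mat_adjoint G * G + mat_adjoint F * F"
    unfolding gram[symmetric] using Z F G by (intro eq_matI) auto
  finally have det: "det (1\<^sub>m n + mat_adjoint T * T) =
      det ?A * det (?P + mat_adjoint G * G + mat_adjoint F * F)" .

  \<comment> \<open>The Gram matrices are added one at a time, that of \<open>F\<close> last. If the
    total determinant equals \<open>det ?P\<close>, both inequalities are equalities, and the second
    gives \<open>F = 0\<close>.\<close>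
  note G1 = det_pos_def_plus_gram(1)[OF P G]
  note F1 = det_pos_def_plus_gram[OF pos_def_mat_plus_gram[OF P G] F]
  have le: "det ?A * det ?P \<le> det (1\<^sub>m n + mat_adjoint T * T)"
    unfolding det using G1 F1(1) dA by (intro mult_left_mono) auto
  have "Y = 0\<^sub>m r m" if "det (1\<^sub>m n + mat_adjoint T * T) = det ?A * det ?P"
  proof -
    have "det (?P + mat_adjoint G * G + mat_adjoint F * F) = det ?P"
      using that dA unfolding det by auto
    then have "F = 0\<^sub>m r m"
      using G1 F1 by (metis order_antisym)
    then show ?thesis
      using BF X by auto
  qed
  moreover have "det (1\<^sub>m n + mat_adjoint T * T) = det ?A * det ?P" if "Y = 0\<^sub>m r m"
  proof -
    have "F = 0\<^sub>m r m" and "G = 0\<^sub>m r m"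
      using that right_mult_zero_mat[OF K(1)] right_mult_zero_mat[OF Xa]
      by (auto simp: F_def G_def)
    moreover have "?P + mat_adjoint (0\<^sub>m r m) * 0\<^sub>m r m + mat_adjoint (0\<^sub>m r m) * 0\<^sub>m r m = ?P"
      using Z by (intro eq_matI) auto
    ultimately show ?thesis
      unfolding det by simp
  qed
  ultimately show ?thesis
    using le unfolding m_def by blast
qed

end
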